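(* Let $0<\alpha<1$, let $n\ge3$ be an integer and let $j$ be even, $1\le j\le n$. Then the number $\vartheta_{\alpha,n,j}$ is the unique solution on $[0,\pi]$ of the equation $$x=d_{n,j}+\frac{\eta_\alpha(x)}{n}.$$
   Context: For an integer $n\ge3$ and a real number $\alpha$, $L_{\alpha,n}$ is the real symmetric $n\times n$ matrix with entries: $(L_{\alpha,n})_{1,1}=(L_{\alpha,n})_{n,n}=1+\alpha$; $(L_{\alpha,n})_{k,k}=2$ for $2\le k\le n-1$; $(L_{\alpha,n})_{k,k+1}=(L_{\alpha,n})_{k+1,k}=-1$ for $1\le k\le n-1$; $(L_{\alpha,n})_{1,n}=(L_{\alpha,n})_{n,1}=-\alpha$; all other entries are $0$. Its eigenvalues, counted with multiplicity, are $\lambda_{\alpha,n,1}\le\dots\le\lambda_{\alpha,n,n}$; for $0<\alpha<1$ they belong to $[0,4]$. Let $g(x)=2-2\cos x=4\sin^2(x/2)$, which is a bijection of $[0,\pi]$ onto $[0,4]$; $\vartheta_{\alpha,n,j}$ is the unique number in $[0,\pi]$ with $g(\vartheta_{\alpha,n,j})=\lambda_{\alpha,n,j}$. Put $d_{n,j}=\frac{(j-1)\pi}{n}$ and $\varkappa_\alpha=\frac{\alpha}{1-\alpha}$. The function $\eta_\alpha\colon[0,\pi]\to\mathbb{R}$ is $\eta_\alpha(x)=2\arctan\left(\varkappa_\alpha\cot\frac{x}{2}\right)$ for $0<x\le\pi$, with $\eta_\alpha(0)=\pi$ (continuous extension). *)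

theory Defs
  imports
    Complex_Main
    "HOL-Library.Multiset"
    "HOL-Computational_Algebra.Polynomial"
    "Jordan_Normal_Form.Char_Poly"
begin

text \<open>Matrix indices are 0-based here, so the mathematical rows $1$ and $n$ are the rows
  \<open>0\<close> and \<open>n - 1\<close>. For $n \ge 3$ the corner entries do not collide with the off-diagonals.\<close>

definition L :: "real \<Rightarrow> nat \<Rightarrow> real mat" where
  "L \<alpha> n = mat n n (\<lambda>(i, k).
     if i = k then (if i = 0 \<or> i = n - 1 then 1 + \<alpha> else 2)
     else if k = i + 1 \<or> i = k + 1 then - 1
     else if (i = 0 \<and> k = n - 1) \<or> (i = n - 1 \<and> k = 0) then - \<alpha>
     else 0)"

text \<open>The \<open>j\<close>-th smallest eigenvalue (\<open>j\<close> counted from 1), with eigenvalues repeated according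
  to their multiplicity as roots of the characteristic polynomial. Since \<^term>\<open>L \<alpha> n\<close> is real
  symmetric, this agrees with the geometric multiplicity, and the list has length \<open>n\<close>.\<close>

definition eigval :: "real \<Rightarrow> nat \<Rightarrow> nat \<Rightarrow> real" where
  "eigval \<alpha> n j = sorted_list_of_multiset (proots (char_poly (L \<alpha> n))) ! (j - 1)"

definition g :: "real \<Rightarrow> real" where
  "g x = 2 - 2 * cos x"

definition theta :: "real \<Rightarrow> nat \<Rightarrow> nat \<Rightarrow> real" where
  "theta \<alpha> n j = (THE x. x \<in> {0..pi} \<and> g x = eigval \<alpha> n j)"

definition d :: "nat \<Rightarrow> nat \<Rightarrow> real" where
  "d n j = (real j - 1) * pi / real n"

definition kappa :: "real \<Rightarrow> real" where
  "kappa \<alpha> = \<alpha> / (1 - \<alpha>)"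

text \<open>Only the values on the interval from \<open>0\<close> to \<open>pi\<close> are meaningful. The value at \<open>0\<close> is the
  continuous extension; it must be given separately because \<open>cot 0 = 0\<close> by convention.\<close>

definition eta :: "real \<Rightarrow> real \<Rightarrow> real" where
  "eta \<alpha> x = (if x = 0 then pi else 2 * arctan (kappa \<alpha> * cot (x / 2)))"

end

theory Submission
  imports Defs
begin

text \<open>Write \<open>\<lambda> = g x\<close>. The reflection \<open>i \<mapsto> n - 1 - i\<close> commutes with \<open>L \<alpha> n\<close>, so one looks for
  eigenvectors \<open>cos ((i - (n - 1) / 2) x)\<close> and \<open>sin ((i - (n - 1) / 2) x)\<close>. The boundary rows
  hold for the former when \<open>x = d n j\<close> with \<open>j\<close> odd, and for the latter when
  \<open>\<alpha> sin (n x / 2) cos (x / 2) + (1 - \<alpha>) cos (n x / 2) sin (x / 2) = 0\<close>, which is the given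
  equation with \<open>j\<close> even. Its solution lies strictly between \<open>d n j\<close> and \<open>d n (j + 1)\<close>, so the two
  families interlace and yield \<open>n\<close> distinct eigenvalues in increasing order, hence all of them.\<close>

section \<open>Simple roots of a polynomial and monotonicity of \<open>g\<close>\<close>

text \<open>Each listed root has order at least 1, so \<open>mset xs\<close> is contained in
  \<open>proots p\<close>; the degree bounds the size of the latter, which forces equality.\<close>

lemma proots_eq_mset:
  fixes p :: "'a::idom poly"
  assumes "distinct xs" and "\<And>x. x \<in> set xs \<Longrightarrow> poly p x = 0" and "p \<noteq> 0"
    and "degree p = length xs"
  shows "proots p = mset xs"
proof -
  have "mset xs \<subseteq># proots p"
  proof (rule mset_subset_eqI)
    fix a
    show "count (mset xs) a \<le> count (proots p) a"
    proof (cases "a \<in> set xs")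
      case True
      then have "order a p \<noteq> 0"
        using assms(2,3) order_root by blast
      moreover have "count (mset xs) a = 1"
        using True assms(1) by (simp add: distinct_count_atmost_1)
      ultimately show ?thesis
        using assms(3) by simp
    next
      case False
      then have "count (mset xs) a = 0"
        by (metis count_eq_zero_iff set_mset_mset)
      then show ?thesis
        by (simp only: le0)
    qed
  qed
  moreover have "size (proots p) \<le> size (mset xs)"
    using size_proots_le[of p] assms(4) by simp
  ultimately show ?thesis
    by (metis mset_subset_size not_le subset_mset.le_imp_less_or_eq)
qed

lemma g_strict_mono:
  assumes "0 \<le> x" "x < y" "y \<le> pi"
  shows "g x < g y"
  using cos_monotone_0_pi[of x y] assms by (simp add: g_def)

section \<open>Even and odd eigenvectors\<close>

text \<open>Interior rows are the recurrence \<open>rec\<close> itself. In the two corner rows the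
  recurrence would use the values at \<open>- c - 1\<close> and \<open>c + 1\<close>, outside the
  sampled range; \<open>left\<close> and \<open>right\<close> replace them by exactly what the
  corner entries supply.\<close>

lemma L_mult_vec_eq:
  fixes u :: "real \<Rightarrow> real"
  assumes n: "n \<ge> 3"
    and rec: "\<And>t. u (t - 1) + u (t + 1) = 2 * cos x * u t"
    and left: "u (- c - 1) = (1 - \<alpha>) * u (- c) + \<alpha> * u c"
    and right: "u (c + 1) = (1 - \<alpha>) * u c + \<alpha> * u (- c)"
    and c: "c = (real n - 1) / 2"
  defines "v \<equiv> vec n (\<lambda>i. u (real i - c))"
  shows "L \<alpha> n *\<^sub>v v = g x \<cdot>\<^sub>v v"
proof (rule eq_vecI)
  show "dim_vec (L \<alpha> n *\<^sub>v v) = dim_vec (g x \<cdot>\<^sub>v v)"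
    by (simp add: v_def L_def)
  fix i assume "i < dim_vec (g x \<cdot>\<^sub>v v)"
  then have i: "i < n"
    by (simp add: v_def)
  define f where "f k = L \<alpha> n $$ (i, k) * u (real k - c)" for k
  have 1: "(L \<alpha> n *\<^sub>v v) $ i = sum f {0..<n}"
    using i by (simp add: v_def f_def L_def scalar_prod_def)
  have u1: "real (n - 1) - c = c"
    using n c by (simp add: field_simps of_nat_diff)
  have "sum f {0..<n} = g x * u (real i - c)"
  proof -
    consider "i = 0" | "i = n - 1" "i \<noteq> 0" | "0 < i" "i < n - 1"
      using i by linarith
    then show ?thesis
    proof cases
      case 1
      \<comment> \<open>Since \<open>n \<ge> 3\<close>, the three columns are distinct and the sum
        splits into three terms.\<close>
      have "sum f {0..<n} = sum f {0, 1, n - 1}"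
        using n 1 by (intro sum.mono_neutral_right) (auto simp: f_def L_def)
      also have "\<dots> = (1 + \<alpha>) * u (- c) - u (1 - c) - \<alpha> * u c"
        using n 1 u1 by (simp add: f_def L_def)
      also have "\<dots> = g x * u (- c)"
        using rec[of "- c"] left by (simp add: g_def algebra_simps)
      finally show ?thesis
        using 1 by simp
    next
      case 2
      have "sum f {0..<n} = sum f {0, n - 2, n - 1}"
        using n 2 by (intro sum.mono_neutral_right) (auto simp: f_def L_def)
      also have "\<dots> = f 0 + f (n - 2) + f (n - 1)"
        using n by simp
      also have "\<dots> = (1 + \<alpha>) * u c - u (c - 1) - \<alpha> * u (- c)"
      proof -
        have "real (n - 2) - c = c - 1"
          using n c by (simp add: field_simps of_nat_diff)
        moreover have "L \<alpha> n $$ (n - 1, 0) = - \<alpha>" "L \<alpha> n $$ (n - 1, n - 2) = - 1"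
          "L \<alpha> n $$ (n - 1, n - 1) = 1 + \<alpha>"
          using n by (auto simp: L_def)
        ultimately show ?thesis
          using 2 u1 by (simp add: f_def)
      qed
      also have "\<dots> = g x * u c"
        using rec[of c] right by (simp add: g_def algebra_simps)
      finally show ?thesis
        using 2 u1 by simp
    next
      case 3
      have "sum f {0..<n} = sum f {i - 1, i, i + 1}"
        using n 3 by (intro sum.mono_neutral_right) (auto simp: f_def L_def)
      also have "\<dots> = f (i - 1) + f i + f (i + 1)"
      proof -
        have "i - 1 \<noteq> i" "i - 1 \<noteq> i + 1"
          using 3 by linarith+
        then show ?thesis
          by (simp add: add.assoc)
      qed
      also have "\<dots> = 2 * u (real i - c) - u (real i - c - 1) - u (real i - c + 1)"
      proof -
        have args: "real (i - 1) - c = real i - c - 1" "real (i + 1) - c = real i - c + 1"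
          using 3 by (simp_all add: of_nat_diff)
        have entries: "L \<alpha> n $$ (i, i - 1) = - 1" "L \<alpha> n $$ (i, i) = 2"
          "L \<alpha> n $$ (i, i + 1) = - 1"
          using 3 by (auto simp: L_def)
        show ?thesis
          unfolding f_def args entries by simp
      qed
      also have "\<dots> = g x * u (real i - c)"
        using rec[of "real i - c"] by (simp add: g_def algebra_simps)
      finally show ?thesis .
    qed
  qed
  then show "(L \<alpha> n *\<^sub>v v) $ i = (g x \<cdot>\<^sub>v v) $ i"
    using 1 i by (simp add: v_def)
qed

lemma eigenvalue_LI:
  fixes u :: "real \<Rightarrow> real"
  assumes "n \<ge> 3"
    and "\<And>t. u (t - 1) + u (t + 1) = 2 * cos x * u t"
    and "u (- c - 1) = (1 - \<alpha>) * u (- c) + \<alpha> * u c"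
    and "u (c + 1) = (1 - \<alpha>) * u c + \<alpha> * u (- c)"
    and "c = (real n - 1) / 2"
    and nz: "u (- c) \<noteq> 0 \<or> u (1 - c) \<noteq> 0"
  shows "eigenvalue (L \<alpha> n) (g x)"
proof -
  define v where "v = vec n (\<lambda>i. u (real i - c))"
  have "v $ 0 = u (- c)" "v $ 1 = u (1 - c)"
    using assms(1) by (simp_all add: v_def)
  then have "v \<noteq> 0\<^sub>v n"
    using nz assms(1) by auto
  moreover have "L \<alpha> n *\<^sub>v v = g x \<cdot>\<^sub>v v"
    unfolding v_def by (rule L_mult_vec_eq) fact+
  ultimately have "eigenvector (L \<alpha> n) v (g x)"
    by (auto simp: eigenvector_def v_def L_def)
  then show ?thesis
    by (auto simp: eigenvalue_def)
qed

text \<open>For the even function \<open>cos (t * x)\<close> both boundary conditions reduce to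
  \<open>cos ((c + 1) * x) = cos (c * x)\<close>, free of \<alpha>; the two sides differ by
  \<open>2 * sin (n * x / 2) * sin (x / 2)\<close> up to sign. The case \<open>x = 0\<close> gives
  the constant vector.\<close>

lemma eigenvalue_L_cos:
  assumes n: "n \<ge> 3" and x: "0 \<le> x" "x < pi" and eq: "sin (real n * x / 2) = 0"
  shows "eigenvalue (L \<alpha> n) (g x)"
proof -
  define c where "c = (real n - 1) / 2"
  have neg: "(- c - 1) * x = - ((c + 1) * x)"
    by (simp add: algebra_simps)
  have "(c + 1) * x = real n * x / 2 + x / 2" "c * x = real n * x / 2 - x / 2"
    by (simp_all add: c_def field_simps)
  then have "cos ((c + 1) * x) = cos (c * x)"
    using eq by (simp add: cos_add cos_diff)
  moreover have "cos ((- c - 1) * x) = cos ((c + 1) * x)"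
    by (simp only: neg cos_minus)
  moreover have "cos ((t - 1) * x) + cos ((t + 1) * x) = 2 * cos x * cos (t * x)" for t
    by (simp add: algebra_simps cos_add cos_diff)
  \<comment> \<open>Two adjacent zeros would force \<open>sin x = 0\<close>, hence
    \<open>x = 0\<close>, where the cosine is 1.\<close>
  moreover have "cos (- c * x) \<noteq> 0 \<or> cos ((1 - c) * x) \<noteq> 0"
  proof (rule ccontr)
    assume "\<not> ?thesis"
    then have z: "cos (c * x) = 0" "cos (x - c * x) = 0"
      by (simp_all add: algebra_simps)
    then have "sin x * sin (c * x) = 0"
      by (simp add: cos_diff)
    moreover have "sin (c * x) \<noteq> 0"
      using z(1) sin_cos_squared_add[of "c * x"] by auto
    ultimately have "sin x = 0"
      by simp
    then have "x = 0"
      using x sin_gt_zero[of x] by fastforce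
    then show False
      using z by simp
  qed
  ultimately show ?thesis
    using n by (intro eigenvalue_LI[where u = "\<lambda>t. cos (t * x)" and c = c])
      (auto simp: c_def algebra_simps)
qed

text \<open>For the odd function \<open>sin (t * x)\<close> both boundary conditions reduce to
  \<open>sin ((c + 1) * x) = (1 - 2 * \<alpha>) * sin (c * x)\<close>; expanding around
  \<open>n * x / 2\<close> gives twice \<open>eq\<close>.\<close>

lemma eigenvalue_L_sin:
  assumes n: "n \<ge> 3" and x: "0 < x" "x < pi"
    and eq: "\<alpha> * sin (real n * x / 2) * cos (x / 2) + (1 - \<alpha>) * cos (real n * x / 2) * sin (x / 2) = 0"
  shows "eigenvalue (L \<alpha> n) (g x)"
proof -
  define c where "c = (real n - 1) / 2"
  have neg: "(- c - 1) * x = - ((c + 1) * x)"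
    by (simp add: algebra_simps)
  have *: "(c + 1) * x = real n * x / 2 + x / 2" "c * x = real n * x / 2 - x / 2"
    by (simp_all add: c_def field_simps)
  have 1: "sin ((c + 1) * x) = (1 - 2 * \<alpha>) * sin (c * x)"
    unfolding * sin_add sin_diff using eq by (simp add: algebra_simps)
  have 2: "sin ((- c - 1) * x) = - sin ((c + 1) * x)"
    by (simp only: neg sin_minus)
  have 3: "sin ((t - 1) * x) + sin ((t + 1) * x) = 2 * cos x * sin (t * x)" for t
    by (simp add: algebra_simps sin_add sin_diff)
  have 4: "sin (- c * x) \<noteq> 0 \<or> sin ((1 - c) * x) \<noteq> 0"
  proof (rule ccontr)
    assume "\<not> ?thesis"
    then have z: "sin (c * x) = 0" "sin (x - c * x) = 0"
      by (simp_all add: algebra_simps)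
    then have "sin x * cos (c * x) = 0"
      by (simp add: sin_diff)
    moreover have "cos (c * x) \<noteq> 0"
      using z(1) sin_cos_squared_add[of "c * x"] by auto
    ultimately show False
      using x sin_gt_zero[of x] by simp
  qed
  show ?thesis
    by (rule eigenvalue_LI[where u = "\<lambda>t. sin (t * x)" and c = c, OF n 3 _ _ c_def 4])
      (simp_all only: 1 2, simp_all add: algebra_simps)
qed

section \<open>The function \<open>eta\<close> and the solutions of its equation\<close>

lemma cot_strict_antimono:
  fixes x y :: real
  assumes "0 < x" "x < y" "y < pi"
  shows "cot y < cot x"
proof -
  have s: "sin x > 0" "sin y > 0" "sin (y - x) > 0"
    using assms by (auto intro!: sin_gt_zero)
  then have "cot x - cot y = sin (y - x) / (sin x * sin y)"
    by (simp add: cot_def sin_diff field_simps)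
  then show ?thesis
    using s by (metis diff_gt_0_iff_gt divide_pos_pos mult_pos_pos)
qed

context
  fixes \<alpha> :: real
  assumes \<alpha>: "0 < \<alpha>" "\<alpha> < 1"
begin

lemma kappa_pos: "kappa \<alpha> > 0"
  using \<alpha> by (simp add: kappa_def)

lemma eta_less_pi: "0 < x \<Longrightarrow> eta \<alpha> x < pi"
  using arctan_ubound[of "kappa \<alpha> * cot (x / 2)"] by (simp add: eta_def)

lemma eta_pos:
  assumes "0 \<le> x" "x < pi"
  shows "eta \<alpha> x > 0"
  using assms kappa_pos cot_gt_zero[of "x / 2"] by (auto simp: eta_def)

lemma eta_nonneg:
  assumes "0 \<le> x" "x \<le> pi"
  shows "eta \<alpha> x \<ge> 0"
  using eta_pos[of x] assms by (cases "x = pi") (auto simp: eta_def cot_def)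

text \<open>Away from 0 this is a decreasing cotangent inside an increasing arctangent; the value
  \<open>pi\<close> at 0 lies above all values of \<open>2 * arctan\<close>.\<close>

lemma eta_strict_antimono:
  assumes "0 \<le> x" "x < y" "y \<le> pi"
  shows "eta \<alpha> y < eta \<alpha> x"
proof (cases "x = 0")
  case True
  then show ?thesis
    using eta_less_pi[of y] assms by (simp add: eta_def)
next
  case False
  then have "cot (y / 2) < cot (x / 2)"
    using assms by (intro cot_strict_antimono) auto
  then show ?thesis
    using False assms kappa_pos by (simp add: eta_def arctan_less_iff)
qed

text \<open>Between two solutions the left side would strictly increase while the right side does
  not.\<close>

lemma eta_equation_unique:
  assumes "x \<in> {0..pi}" "x = d n j + eta \<alpha> x / real n"
    and "y \<in> {0..pi}" "y = d n j + eta \<alpha> y / real n"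
  shows "x = y"
proof -
  have False if "a < b" "0 \<le> a" "b \<le> pi" "a = d n j + eta \<alpha> a / real n"
    "b = d n j + eta \<alpha> b / real n" for a b
  proof -
    have "eta \<alpha> b / real n \<le> eta \<alpha> a / real n"
      using eta_strict_antimono[of a b] that(1-3) by (intro divide_right_mono) auto
    then show False
      using that by linarith
  qed
  then show ?thesis
    using assms by (metis atLeastAtMost_iff linorder_neq_iff)
qed

text \<open>Intermediate value theorem on an interval of length \<open>pi / n\<close>, using that
  \<open>eta\<close> lies between 0 and \<open>pi\<close>. The bound \<open>2 \<le> j\<close> keeps
  the interval away from the pole of the cotangent at 0.\<close>

lemma eta_equation_solvable:
  assumes "n \<ge> 1" "2 \<le> j" "j \<le> n"
  obtains x where "d n j < x" "x < d n (j + 1)" "x = d n j + eta \<alpha> x / real n"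
proof -
  have n: "real n > 0"
    using assms by simp
  have bounds: "0 < d n j" "d n j < d n (j + 1)" "d n (j + 1) \<le> pi"
    using assms by (auto simp: d_def divide_simps)
  have step: "d n (j + 1) = d n j + pi / real n"
    by (simp add: d_def algebra_simps add_divide_distrib diff_divide_distrib)
  \<comment> \<open>The case distinction of \<open>eta\<close> is dropped so that continuity follows
    by composition.\<close>
  define F where "F x = x - 2 * arctan (kappa \<alpha> * cot (x / 2)) / real n" for x
  have F: "F x = x - eta \<alpha> x / real n" if "x > 0" for x
    using that by (simp add: F_def eta_def)
  have "continuous_on {d n j..d n (j + 1)} F"
    unfolding F_def cot_def
  proof (intro continuous_intros ballI)
    fix x assume "x \<in> {d n j..d n (j + 1)}"
    then show "sin (x / 2) \<noteq> 0"
      using bounds sin_gt_zero[of "x / 2"] by auto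
  qed (use n in auto)
  moreover have "F (d n j) \<le> d n j"
    using F[of "d n j"] bounds eta_nonneg[of "d n j"] n by simp
  moreover have "d n j \<le> F (d n (j + 1))"
  proof -
    have "eta \<alpha> (d n (j + 1)) / real n \<le> pi / real n"
      using bounds eta_less_pi[of "d n (j + 1)"] n by (intro divide_right_mono) auto
    then show ?thesis
      using F[of "d n (j + 1)"] bounds step by linarith
  qed
  ultimately obtain x where x: "d n j \<le> x" "x \<le> d n (j + 1)" "F x = d n j"
    using IVT'[of F "d n j" "d n j" "d n (j + 1)"] bounds by auto
  then have eq: "x = d n j + eta \<alpha> x / real n"
    using F[of x] bounds by simp
  have "eta \<alpha> x / real n < pi / real n"
    using x bounds n by (intro divide_strict_right_mono eta_less_pi) auto
  \<comment> \<open>The upper bound comes first: it gives \<open>x < pi\<close>, where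
    \<open>eta\<close> is positive, and this yields the strict lower bound.\<close>
  then have lt: "x < d n (j + 1)"
    using eq step by linarith
  have "eta \<alpha> x / real n > 0"
    using x bounds lt n by (intro divide_pos_pos eta_pos) auto
  then have "d n j < x"
    using eq by linarith
  then show thesis
    using that lt eq by blast
qed

section \<open>Identification of the whole spectrum\<close>

lemma eta_equation_imp_eigenvalue:
  assumes n: "n \<ge> 3" and j: "even j" and x: "0 < x" "x < pi"
    and eq: "x = d n j + eta \<alpha> x / real n"
  shows "eigenvalue (L \<alpha> n) (g x)"
proof -
  obtain m where m: "j = 2 * m"
    using j by blast
  define \<phi> where "\<phi> = arctan (kappa \<alpha> * cot (x / 2))"
  have "real n * x = (real j - 1) * pi + 2 * \<phi>"
    using arg_cong[OF eq, of "\<lambda>y. real n * y"] x n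
    by (simp add: d_def eta_def \<phi>_def distrib_left)
  \<comment> \<open>As \<open>j = 2 * m\<close>, the offset is \<open>m * pi - pi / 2\<close>: the
    quarter turn swaps sine and cosine, and \<open>m * pi\<close> contributes only a common
    sign.\<close>
  then have y: "real n * x / 2 = (\<phi> + real m * pi) - pi / 2"
    by (simp add: m field_simps)
  have c: "cos (real n * x / 2) = (-1) ^ m * sin \<phi>"
    unfolding y cos_diff by (simp add: sin_add)
  have s: "sin (real n * x / 2) = - ((-1) ^ m * cos \<phi>)"
    unfolding y sin_diff by (simp add: cos_add)
  have "sin (x / 2) > 0"
    using x by (intro sin_gt_zero) auto
  \<comment> \<open>The definition of \<open>\<phi>\<close> as an arctangent, cleared of its
    denominator \<open>cos \<phi>\<close>.\<close>
  moreover have "sin \<phi> = kappa \<alpha> * cot (x / 2) * cos \<phi>"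
    using tan_arctan[of "kappa \<alpha> * cot (x / 2)"] cos_arctan_not_zero[of "kappa \<alpha> * cot (x / 2)"]
    unfolding \<phi>_def[symmetric] by (simp add: tan_def field_simps)
  ultimately have "(1 - \<alpha>) * sin \<phi> * sin (x / 2) = \<alpha> * cos \<phi> * cos (x / 2)"
    using \<alpha> by (simp add: kappa_def cot_def)
  then have "\<alpha> * sin (real n * x / 2) * cos (x / 2)
      + (1 - \<alpha>) * cos (real n * x / 2) * sin (x / 2) = 0"
    unfolding c s by (simp add: mult_ac)
  then show ?thesis
    by (rule eigenvalue_L_sin[OF n x])
qed

text \<open>The numbers \<open>g (X i)\<close> are \<open>n\<close> strictly increasing roots of a
  polynomial of degree \<open>n\<close>, so they form its complete sorted list of roots.\<close>

lemma eigval_L_eq_g: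
  assumes n: "n \<ge> 3"
    and odd: "\<And>j. odd j \<Longrightarrow> X j = d n j"
    and even: "\<And>j. even j \<Longrightarrow> 1 \<le> j \<Longrightarrow> j \<le> n \<Longrightarrow>
      d n j < X j \<and> X j < d n (j + 1) \<and> X j = d n j + eta \<alpha> (X j) / real n"
    and j: "1 \<le> j" "j \<le> n"
  shows "eigval \<alpha> n j = g (X j)"
proof -
  have d_less: "d n i < d n (i + 1)" for i
    using n by (simp add: d_def divide_simps)
  have d_le: "d n i \<le> d n k" if "i \<le> k" for i k
    using n that by (simp add: d_def divide_simps)
  have d1: "d n 1 = 0" and dn: "d n (n + 1) = pi"
    using n by (simp_all add: d_def)
  have range: "0 \<le> X i \<and> X i < pi" if "1 \<le> i" "i \<le> n" for i
    using odd[of i] even[of i] d_le[of 1 i] d_le[of "i + 1" "n + 1"] d_less[of i] d1 dn that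
    by (cases "even i") auto
  \<comment> \<open>Odd members are grid points, and each even member lies strictly inside the grid
    cell that starts at its own index.\<close>
  have step: "X i < X (i + 1)" if "1 \<le> i" "i < n" for i
    using odd[of i] even[of i] odd[of "i + 1"] even[of "i + 1"] d_less[of i] that
    by (cases "even i") auto
  have mono: "X i < X k" if "i < k" "1 \<le> i" "k \<le> n" for i k
    using that
  proof (induction k)
    case (Suc k)
    then show ?case
      using step[of k] by (cases "i = k") auto
  qed simp
  have root: "poly (char_poly (L \<alpha> n)) (g (X i)) = 0" if i: "1 \<le> i" "i \<le> n" for i
  proof -
    have "eigenvalue (L \<alpha> n) (g (X i))"
    proof (cases "even i")
      case True
      then have "X i > 0"
        using even[of i] d_le[of 1 i] d1 i by auto
      then show ?thesis
        using eta_equation_imp_eigenvalue[OF n True] even[OF True] range[of i] i by blast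
    next
      case False
      then obtain m where m: "i = 2 * m + 1"
        by (blast elim: oddE)
      have "real n * X i / 2 = real m * pi"
        using n False odd[of i] by (simp add: m d_def)
      then show ?thesis
        using eigenvalue_L_cos[OF n] range[of i] i by (metis sin_npi)
    qed
    then show ?thesis
      using eigenvalue_root_char_poly[of "L \<alpha> n" n] by (simp add: L_def)
  qed
  \<comment> \<open>The shift by 1 matches 0-based list positions with indices counted from
    1.\<close>
  define xs where "xs = map (\<lambda>i. g (X (i + 1))) [0..<n]"
  have sorted: "sorted_wrt (<) xs"
    unfolding xs_def sorted_wrt_map
    by (rule sorted_wrt_mono_rel[OF _ sorted_wrt_upt])
      (use range mono in \<open>auto intro!: g_strict_mono simp: less_imp_le\<close>)
  have "degree (char_poly (L \<alpha> n)) = n \<and> coeff (char_poly (L \<alpha> n)) n = 1"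
    by (rule degree_monic_char_poly) (simp add: L_def)
  then have "proots (char_poly (L \<alpha> n)) = mset xs"
    using sorted root by (intro proots_eq_mset) (auto simp: xs_def strict_sorted_iff)
  then have "sorted_list_of_multiset (proots (char_poly (L \<alpha> n))) = xs"
    using sorted by (simp add: sorted_sort_id strict_sorted_iff)
  moreover have "j - 1 < n" "j - 1 + 1 = j"
    using j by linarith+
  ultimately show ?thesis
    by (simp add: eigval_def xs_def)
qed

end

section \<open>From eigenvalues to \<open>theta\<close>\<close>

lemma theta_eqI:
  assumes "x \<in> {0..pi}" "eigval \<alpha> n j = g x"
  shows "theta \<alpha> n j = x"
  unfolding theta_def
proof (rule the_equality)
  fix y assume "y \<in> {0..pi} \<and> g y = eigval \<alpha> n j"
  then show "y = x"
    using assms g_strict_mono[of x y] g_strict_mono[of y x]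
    by (cases x y rule: linorder_cases) auto
qed (use assms in auto)

theorem theorem2:
  fixes \<alpha> :: real and n j :: nat
  assumes "0 < \<alpha>" and "\<alpha> < 1"
    and "n \<ge> 3"
    and "even j" and "1 \<le> j" and "j \<le> n"
  shows "theta \<alpha> n j \<in> {0..pi}
    \<and> theta \<alpha> n j = d n j + eta \<alpha> (theta \<alpha> n j) / real n
    \<and> (\<forall>x \<in> {0..pi}. x = d n j + eta \<alpha> x / real n \<longrightarrow> x = theta \<alpha> n j)"
proof -
  \<comment> \<open>A whole family is built although \<open>j\<close> is fixed, because the rank of
    one eigenvalue depends on all the others.\<close>
  define P where "P i x \<longleftrightarrow> d n i < x \<and> x < d n (i + 1) \<and> x = d n i + eta \<alpha> x / real n" for i x
  define X where "X i = (if odd i then d n i else SOME x. P i x)" for i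
  have X: "P i (X i)" if "even i" "1 \<le> i" "i \<le> n" for i
  proof -
    have "2 \<le> i"
      using that by (cases "i = 1") auto
    then have "\<exists>x. P i x"
      using eta_equation_solvable[OF assms(1,2), of n i] assms(3) that unfolding P_def by auto
    then show ?thesis
      using that(1) by (simp add: X_def someI_ex)
  qed
  have "eigval \<alpha> n j = g (X j)"
  proof (rule eigval_L_eq_g)
    show "X i = d n i" if "odd i" for i
      using that by (simp add: X_def)
    show "d n i < X i \<and> X i < d n (i + 1) \<and> X i = d n i + eta \<alpha> (X i) / real n"
      if "even i" "1 \<le> i" "i \<le> n" for i
      using X[OF that] unfolding P_def .
  qed (use assms in auto)
  moreover have Xj: "d n j < X j" "X j < d n (j + 1)" "X j = d n j + eta \<alpha> (X j) / real n"
    using X[of j] assms unfolding P_def by blast+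
  moreover have range: "X j \<in> {0..pi}"
  proof -
    have "0 \<le> d n j" "d n (j + 1) \<le> pi"
      using assms by (auto simp: d_def divide_simps)
    then show ?thesis
      using Xj(1,2) unfolding atLeastAtMost_iff by linarith
  qed
  ultimately have "theta \<alpha> n j = X j"
    by (intro theta_eqI)
  then show ?thesis
    using Xj(3) range eta_equation_unique[OF assms(1,2)] by metis
qed

end
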